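(* Let $f:(a,b)\to\mathbb{R}$ be an $\alpha$-differentiable function and $0<\alpha\le 1$. Then, for all $t>a$, $${}_M\mathcal{I}_a^{\alpha,\beta}\big(\mathscr{D}_M^{\alpha,\beta}f(t)\big)=f(t)-f(a),$$ with $\beta>0$.
   Context: For $\beta>0$, $\mathbb{E}_\beta(x)=\sum_{k=0}^\infty \frac{x^k}{\Gamma(\beta k+1)}$ is the one-parameter Mittag-Leffler function. For $\beta>0$ and $t>0$, the local $M$-derivative of order $\alpha$ of a real-valued function $f$ at $t$ is $$\mathscr{D}_M^{\alpha,\beta}f(t)=\lim_{\varepsilon\to 0}\frac{f\big(t\,\mathbb{E}_\beta(\varepsilon t^{-\alpha})\big)-f(t)}{\varepsilon},$$ and $f$ is called $\alpha$-differentiable if this limit exists. For $a\ge0$, $t\ge a$, $\beta>0$ and a function $h$ defined in $(a,t]$, the $M$-integral of order $\alpha$ of $h$ is $${}_M\mathcal{I}_a^{\alpha,\beta}h(t)=\Gamma(\beta+1)\int_a^t\frac{h(x)}{x^{1-\alpha}}\,dx .$$ Both formulas are used here for $0<\alpha\le1$.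
   Formalization: Since f is given only on the open interval (a,b), f(a) is undefined; it is taken to be the right-hand limit of f at a, which is assumed to exist. Without this the formula fails (f = 0 on (a,b), f(a) = 1). The integral is read as a Henstock–Kurzweil integral. *)

theory Defs
  imports "HOL-Analysis.Analysis"
begin

definition mittag_leffler :: "real \<Rightarrow> real \<Rightarrow> real" where
  "mittag_leffler \<beta> x = (\<Sum>k. x ^ k / Gamma (\<beta> * real k + 1))"

definition M_quotient :: "real \<Rightarrow> real \<Rightarrow> (real \<Rightarrow> real) \<Rightarrow> real \<Rightarrow> real \<Rightarrow> real" where
  "M_quotient \<alpha> \<beta> f t \<epsilon> =
     (f (t * mittag_leffler \<beta> (\<epsilon> * t powr (- \<alpha>))) - f t) / \<epsilon>"

definition M_differentiable :: "real \<Rightarrow> real \<Rightarrow> (real \<Rightarrow> real) \<Rightarrow> real \<Rightarrow> bool" where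
  "M_differentiable \<alpha> \<beta> f t \<longleftrightarrow> (\<exists>D. (M_quotient \<alpha> \<beta> f t \<longlongrightarrow> D) (at 0))"

definition M_derivative :: "real \<Rightarrow> real \<Rightarrow> (real \<Rightarrow> real) \<Rightarrow> real \<Rightarrow> real" where
  "M_derivative \<alpha> \<beta> f t = Lim (at 0) (M_quotient \<alpha> \<beta> f t)"

(* The integral is the Henstock-Kurzweil one, which extends the Riemann, improper Riemann
   and Lebesgue integrals: a pointwise derivative need not be integrable in those senses.
   As integral is 0 for non-integrable functions, integrability is a separate predicate. *)

definition M_integrable :: "real \<Rightarrow> real \<Rightarrow> (real \<Rightarrow> real) \<Rightarrow> real \<Rightarrow> bool" where
  "M_integrable \<alpha> a h t \<longleftrightarrow> (\<lambda>x. h x / x powr (1 - \<alpha>)) integrable_on {a<..t}"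

definition M_integral :: "real \<Rightarrow> real \<Rightarrow> real \<Rightarrow> (real \<Rightarrow> real) \<Rightarrow> real \<Rightarrow> real" where
  "M_integral \<alpha> \<beta> a h t =
     Gamma (\<beta> + 1) * integral {a<..t} (\<lambda>x. h x / x powr (1 - \<alpha>))"

end

theory Submission
  imports Defs
begin

text \<open>
  The Mittag-Leffler function has value \<open>1\<close> and derivative \<open>1 / Gamma (\<beta> + 1) > 0\<close> at \<open>0\<close>, so it
  has a local inverse \<open>L\<close> near \<open>1\<close>. Substituting \<open>\<epsilon> = t\<^sup>\<alpha> L (y / t)\<close> in the quotient that defines
  the \<open>M\<close>-derivative \<open>D\<close> of \<open>f\<close> at \<open>t\<close> turns it into an ordinary difference quotient: \<open>f\<close> is
  differentiable at \<open>t > 0\<close> with derivative \<open>Gamma (\<beta> + 1) D / t\<^sup>1\<^sup>-\<^sup>\<alpha>\<close>. The claim is then the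
  fundamental theorem of calculus for the Henstock-Kurzweil integral, which requires continuity
  but not differentiability at the end points.
\<close>

text \<open>Continuity of \<open>f'\<close> at \<open>x\<close> keeps \<open>f'\<close> positive on
  a whole ball around \<open>x\<close>. There \<open>f\<close> is strictly increasing, hence
  injective, and \<open>g\<close> is its inverse on that ball.\<close>

lemma real_local_inverse:
  fixes f f' :: "real \<Rightarrow> real"
  assumes "open S" and "x \<in> S"
    and deriv: "\<And>y. y \<in> S \<Longrightarrow> (f has_field_derivative f' y) (at y)"
    and "isCont f' x" and "f' x > 0"
  obtains g where "g (f x) = x"
    and "(g has_field_derivative inverse (f' x)) (at (f x))"
    and "\<forall>\<^sub>F y in nhds (f x). f (g y) = y"
proof -
  have "\<forall>\<^sub>F y in nhds x. y \<in> S \<and> f' y > 0"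
    using assms eventually_nhds_in_open[OF \<open>open S\<close> \<open>x \<in> S\<close>]
      order_tendstoD(1)[of f' "f' x" "nhds x" 0]
    by (auto simp: eventually_conj_iff tendsto_at_iff_tendsto_nhds[symmetric] isCont_def)
  then obtain r where r: "r > 0" "\<And>y. dist y x < r \<Longrightarrow> y \<in> S \<and> f' y > 0"
    unfolding eventually_nhds_metric by blast
  define U where "U = ball x r"
  have U: "open U" "x \<in> U" "convex U" "\<And>y. y \<in> U \<Longrightarrow> y \<in> S \<and> f' y > 0"
    using r by (auto simp: U_def dist_commute)
  have less: "f u < f v" if "u \<in> U" "v \<in> U" "u < v" for u v
  proof (rule DERIV_pos_imp_increasing[OF \<open>u < v\<close>])
    fix y assume "u \<le> y" "y \<le> v"
    then have "y \<in> U"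
      using that closed_segment_subset[OF _ _ \<open>convex U\<close>, of u v]
      by (auto simp: closed_segment_eq_real_ivl)
    then show "\<exists>d. (f has_real_derivative d) (at y) \<and> 0 < d"
      using U(4) deriv by blast
  qed
  then have inj: "inj_on f U"
    by (metis inj_onI linorder_cases order_less_irrefl)
  have cont: "continuous_on U f"
    using U(4) deriv by (meson DERIV_isCont continuous_at_imp_continuous_on)
  define g where "g = inv_into U f"
  have gf: "g (f y) = y" if "y \<in> U" for y
    using inj that by (simp add: g_def)
  have "(g has_derivative (*) (inverse (f' x))) (at (f x))"
  proof (rule has_derivative_inverse_strong[OF U(1,2) cont gf])
    show "(f has_derivative (*) (f' x)) (at x)"
      using deriv[OF \<open>x \<in> S\<close>] by (simp add: has_field_derivative_def)
    show "(*) (f' x) \<circ> (*) (inverse (f' x)) = id"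
      using \<open>f' x > 0\<close> by (auto simp: fun_eq_iff)
  qed
  \<comment> \<open>\<open>f (g y) = y\<close> is clear for \<open>y\<close> in the image of
    \<open>U\<close>; openness of the image makes it hold on a full neighbourhood of
    \<open>f x\<close>.\<close>
  moreover have "open (f ` U)"
    by (rule invariance_of_domain[OF cont U(1) inj])
  then have "\<forall>\<^sub>F y in nhds (f x). f (g y) = y"
    by (rule eventually_mono[OF eventually_nhds_in_open])
      (use U(2) in \<open>auto simp: gf\<close>)
  ultimately show thesis
    using that gf[OF U(2)] by (simp add: has_field_derivative_def)
qed

lemma mittag_leffler_0 [simp]: "mittag_leffler \<beta> 0 = 1"
  using powser_zero[of "\<lambda>k. 1 / Gamma (\<beta> * real k + 1)"]
  by (simp add: mittag_leffler_def)

text \<open>The series converges for every \<open>x\<close>, but only the behaviour near \<open>0\<close> matters, where the crude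
  bound \<open>Gamma \<ge> 1\<close> on \<open>[2, \<infinity>)\<close> suffices.\<close>

lemma summable_mittag_leffler:
  fixes x :: real
  assumes "\<beta> > 0" and "\<bar>x\<bar> < 1"
  shows "summable (\<lambda>k. 1 / Gamma (\<beta> * real k + 1) * x ^ k)"
proof (rule summable_comparison_test_ev)
  have "filterlim (\<lambda>k. \<beta> * real k) at_top sequentially"
    using \<open>\<beta> > 0\<close> filterlim_real_sequentially
    by (intro filterlim_tendsto_pos_mult_at_top[OF tendsto_const]) auto
  then have "\<forall>\<^sub>F k in sequentially. \<beta> * real k \<ge> 1"
    by (simp add: filterlim_at_top)
  then show "\<forall>\<^sub>F k in sequentially. norm (1 / Gamma (\<beta> * real k + 1) * x ^ k) \<le> \<bar>x\<bar> ^ k"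
  proof eventually_elim
    case (elim k)
    have "Gamma (\<beta> * real k + 1) \<ge> Gamma 2"
      using Gamma_real_strict_mono[of 2 "\<beta> * real k + 1"] elim
      by (cases "\<beta> * real k = 1") auto
    moreover have "Gamma (2::real) = 1"
      using Gamma_fact[of 1, where 'a = real] by simp
    ultimately show ?case
      using mult_left_mono[of 1 "Gamma (\<beta> * real k + 1)" "\<bar>x\<bar> ^ k"]
      by (simp add: abs_mult power_abs divide_simps)
  qed
  show "summable (\<lambda>k. \<bar>x\<bar> ^ k)"
    using assms by (simp add: summable_geometric)
qed

lemma mittag_leffler_local_inverse:
  assumes "\<beta> > 0"
  obtains L where "L 1 = 0"
    and "(L has_field_derivative Gamma (\<beta> + 1)) (at 1)"
    and "\<forall>\<^sub>F y in nhds 1. mittag_leffler \<beta> (L y) = y"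
proof -
  define c where "c = (\<lambda>k. 1 / Gamma (\<beta> * real k + 1))"
  define E' where "E' = (\<lambda>x::real. \<Sum>k. diffs c k * x ^ k)"
  have E: "mittag_leffler \<beta> = (\<lambda>x. \<Sum>k. c k * x ^ k)"
    by (simp add: fun_eq_iff mittag_leffler_def c_def)
  have summable: "summable (\<lambda>k. c k * x ^ k)" if "norm x < 1" for x :: real
    using summable_mittag_leffler[OF assms] that by (simp add: c_def)
  have deriv: "(mittag_leffler \<beta> has_field_derivative E' x) (at x)" if "norm x < 1" for x
    unfolding E E'_def using termdiffs_strong'[OF summable that] .
  have summable': "summable (\<lambda>k. diffs c k * x ^ k)" if "norm x < 1" for x
    using termdiff_converges[OF that summable] .
  \<comment> \<open>Differentiating the series a second time serves only to make \<open>E'\<close>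
    continuous at \<open>0\<close>, as the local inverse requires.\<close>
  have "(E' has_field_derivative (\<Sum>k. diffs (diffs c) k * 0 ^ k)) (at 0)"
    unfolding E'_def by (rule termdiffs_strong'[OF summable', of 1]) simp_all
  then have "isCont E' 0"
    by (rule DERIV_isCont)
  \<comment> \<open>The constant term of the differentiated series is
    \<open>1 * c 1\<close>.\<close>
  moreover have E'0: "E' 0 = inverse (Gamma (\<beta> + 1))"
    using powser_zero[of "diffs c"] by (simp add: E'_def diffs_def c_def inverse_eq_divide)
  moreover have "E' 0 > 0"
    using assms E'0 by (simp add: Gamma_real_pos)
  ultimately show thesis
    using that real_local_inverse[of "ball 0 1" 0 "mittag_leffler \<beta>" E'] deriv
    by (auto simp: E'0)
qed

lemma has_field_derivative_if_M_quotient_tendsto: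
  assumes "\<beta> > 0" and "x > 0"
    and lim: "(M_quotient \<alpha> \<beta> f x \<longlongrightarrow> D) (at 0)"
  shows "(f has_field_derivative Gamma (\<beta> + 1) * (D / x powr (1 - \<alpha>))) (at x)"
proof -
  obtain L where L: "L 1 = 0" "(L has_field_derivative Gamma (\<beta> + 1)) (at 1)"
    "\<forall>\<^sub>F y in nhds 1. mittag_leffler \<beta> (L y) = y"
    using mittag_leffler_local_inverse[OF \<open>\<beta> > 0\<close>] by blast
  \<comment> \<open>\<open>h y\<close> is the increment \<epsilon> at which the perturbed argument
    \<open>x * mittag_leffler \<beta> (\<epsilon> * x powr (- \<alpha>))\<close> equals
    \<open>y\<close>, for \<open>y\<close> near \<open>x\<close>.\<close>
  define h where "h y = x powr \<alpha> * L (y / x)" for y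
  have h0: "h x = 0"
    using \<open>x > 0\<close> L(1) by (simp add: h_def)
  have "(L has_field_derivative Gamma (\<beta> + 1)) (at (x / x))"
    using L(2) \<open>x > 0\<close> by simp
  then have "((\<lambda>y. L (y / x)) has_field_derivative Gamma (\<beta> + 1) * (1 / x)) (at x)"
    by (rule DERIV_chain2) (rule DERIV_cdivide[OF DERIV_ident])
  then have dh: "(h has_field_derivative x powr \<alpha> * (Gamma (\<beta> + 1) * (1 / x))) (at x)"
    unfolding h_def by (rule DERIV_cmult)
  have "isCont (\<lambda>y. y / x) x"
    using \<open>x > 0\<close> by (intro continuous_intros) auto
  then have "filterlim (\<lambda>y. y / x) (nhds 1) (at x)"
    using \<open>x > 0\<close> by (simp add: isCont_def)
  from eventually_compose_filterlim[OF L(3) this]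
  have inverse: "\<forall>\<^sub>F y in at x. mittag_leffler \<beta> (L (y / x)) = y / x \<and> y \<noteq> x"
    by (intro eventually_conj) (auto simp: eventually_at_filter)
  \<comment> \<open>If \<open>h y = 0\<close>, then \<open>L (y / x) = 0\<close> and
    \<open>y / x = mittag_leffler \<beta> 0 = 1\<close>, contradicting \<open>y \<noteq> x\<close>.
    Avoiding \<open>0\<close> lets \<open>h\<close> be composed with the punctured limit
    \<open>lim\<close>.\<close>
  then have "\<forall>\<^sub>F y in at x. h y \<noteq> 0"
    by eventually_elim (use \<open>x > 0\<close> in \<open>auto simp: h_def\<close>)
  moreover have "(h \<longlongrightarrow> 0) (at x)"
    using DERIV_isCont[OF dh] h0 by (simp add: isCont_def)
  ultimately have "filterlim h (at 0) (at x)"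
    by (simp add: filterlim_at)
  then have "((\<lambda>y. M_quotient \<alpha> \<beta> f x (h y)) \<longlongrightarrow> D) (at x)"
    by (rule filterlim_compose[OF lim])
  moreover have "((\<lambda>y. h y / (y - x)) \<longlongrightarrow> x powr \<alpha> * (Gamma (\<beta> + 1) * (1 / x))) (at x)"
    using dh h0 by (simp add: has_field_derivative_iff)
  \<comment> \<open>The factor \<open>h y / (y - x)\<close> changes the denominator of the quotient
    from \<open>h y\<close> to \<open>y - x\<close>; its limit is the derivative of \<open>h\<close>
    at \<open>x\<close>.\<close>
  ultimately have lim_prod: "((\<lambda>y. M_quotient \<alpha> \<beta> f x (h y) * (h y / (y - x)))
      \<longlongrightarrow> D * (x powr \<alpha> * (Gamma (\<beta> + 1) * (1 / x)))) (at x)"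
    by (rule tendsto_mult)
  have limit_eq: "D * (x powr \<alpha> * (Gamma (\<beta> + 1) * (1 / x)))
      = Gamma (\<beta> + 1) * (D / x powr (1 - \<alpha>))"
    using \<open>x > 0\<close> by (simp add: powr_diff)
  have "\<forall>\<^sub>F y in at x.
      M_quotient \<alpha> \<beta> f x (h y) * (h y / (y - x)) = (f y - f x) / (y - x)"
    using inverse \<open>\<forall>\<^sub>F y in at x. h y \<noteq> 0\<close>
  proof eventually_elim
    case (elim y)
    have "h y * x powr (- \<alpha>) = L (y / x)"
      using \<open>x > 0\<close> by (simp add: h_def powr_minus)
    then show ?case
      using elim \<open>x > 0\<close> by (simp add: M_quotient_def)
  qed
  from Lim_transform_eventually[OF lim_prod[unfolded limit_eq] this]
  show ?thesis
    unfolding has_field_derivative_iff .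
qed

lemma has_field_derivative_if_M_differentiable:
  assumes "\<beta> > 0" and "x > 0" and "M_differentiable \<alpha> \<beta> f x"
  shows "(f has_field_derivative Gamma (\<beta> + 1) * (M_derivative \<alpha> \<beta> f x / x powr (1 - \<alpha>))) (at x)"
  using assms has_field_derivative_if_M_quotient_tendsto
  by (auto simp: M_differentiable_def M_derivative_def tendsto_Lim)

theorem theorem10:
  fixes f :: "real \<Rightarrow> real" and a b \<alpha> \<beta> :: real
  assumes "0 \<le> a"
    and "0 < \<alpha>" and "\<alpha> \<le> 1"
    and "0 < \<beta>"
    and "\<forall>x\<in>{a<..<b}. M_differentiable \<alpha> \<beta> f x"
    and "(f \<longlongrightarrow> f a) (at_right a)"
  shows "\<forall>t\<in>{a<..<b}. M_integrable \<alpha> a (M_derivative \<alpha> \<beta> f) t \<and>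
           M_integral \<alpha> \<beta> a (M_derivative \<alpha> \<beta> f) t = f t - f a"
proof
  fix t assume t: "t \<in> {a<..<b}"
  define h where "h = (\<lambda>x. M_derivative \<alpha> \<beta> f x / x powr (1 - \<alpha>))"
  have pos: "Gamma (\<beta> + 1) > 0"
    using \<open>0 < \<beta>\<close> by (simp add: Gamma_real_pos)
  \<comment> \<open>Here \<open>0 \<le> a\<close> makes \<open>x\<close> positive, and
    \<open>t < b\<close> allows the case \<open>x = t\<close>.\<close>
  have deriv: "(f has_field_derivative Gamma (\<beta> + 1) * h x) (at x)" if "a < x" "x \<le> t" for x
    using has_field_derivative_if_M_differentiable[of \<beta> x \<alpha> f] assms t that by (auto simp: h_def)
  have "continuous_on {a..t} f"
    unfolding continuous_on_eq_continuous_within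
  proof
    fix x assume x: "x \<in> {a..t}"
    show "continuous (at x within {a..t}) f"
    proof (cases "x = a")
      case True
      then show ?thesis
        \<comment> \<open>At \<open>a\<close> there may be no derivative; the assumed right limit
          gives the one-sided continuity.\<close>
        using assms(6) t by (simp add: continuous_within at_within_Icc_at_right)
    next
      case False
      then have "isCont f x"
        using x deriv[of x] by (intro DERIV_isCont) auto
      then show ?thesis
        by (rule continuous_at_imp_continuous_within)
    qed
  qed
  then have "((\<lambda>x. Gamma (\<beta> + 1) * h x) has_integral f t - f a) {a..t}"
    using t deriv
    by (intro fundamental_theorem_of_calculus_interior)
      (auto simp: has_real_derivative_iff_has_vector_derivative[symmetric])
  \<comment> \<open>The fundamental theorem speaks of \<open>{a..t}\<close>, the M-integral of
    \<open>{a<..t}\<close>; they differ only in the point \<open>a\<close>.\<close>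
  moreover have "negligible {x \<in> {a..t} - {a<..t}. Gamma (\<beta> + 1) * h x \<noteq> 0}"
    by (rule negligible_subset[OF negligible_sing[of a]]) auto
  moreover have "negligible {x \<in> {a<..t} - {a..t}. Gamma (\<beta> + 1) * h x \<noteq> 0}"
    by (rule negligible_subset[OF negligible_empty]) auto
  ultimately have "((\<lambda>x. Gamma (\<beta> + 1) * h x) has_integral f t - f a) {a<..t}"
    by (rule has_integral_spike_set_eq[THEN iffD1, rotated 2])
  from has_integral_mult_right[OF this, of "inverse (Gamma (\<beta> + 1))"]
  have "(h has_integral (f t - f a) / Gamma (\<beta> + 1)) {a<..t}"
    using pos by (simp add: divide_inverse_commute flip: mult.assoc)
  then show "M_integrable \<alpha> a (M_derivative \<alpha> \<beta> f) t \<and>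
      M_integral \<alpha> \<beta> a (M_derivative \<alpha> \<beta> f) t = f t - f a"
    using pos unfolding M_integrable_def M_integral_def h_def[symmetric]
    by (auto simp: integral_unique)
qed

end
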